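(* The combinatorial principle $\diamondsuit(\mathrm{hom}_{\mathrm{H}})$ implies the existence of a stable ordered-union ultrafilter on $[\omega]^{<\omega}$ of character $\omega_1$.
   Context: $[\omega]^{<\omega}$ is the set of finite subsets of $\omega$. For $X\subseteq[\omega]^{<\omega}$, $\mathrm{FU}(X)=\{\bigcup F : F\in[X]^{<\omega}\setminus\{\varnothing\}\}$. A family $X\subseteq[\omega]^{<\omega}$ is ordered (a block sequence) if for all distinct $x,y\in X$, either $\max(x)<\min(y)$ or $\max(y)<\min(x)$. A set $A\subseteq[\omega]^{<\omega}$ is FU-reaped by a block sequence $X$ if $\mathrm{FU}(X)\subseteq A$ or $\mathrm{FU}(X)\cap A=\varnothing$. The principle $\diamondsuit(\mathrm{hom}_{\mathrm{H}})$ states: for every Borel function $F:2^{<\omega_1}\to\mathcal P([\omega]^{<\omega})$ (Borel meaning that for each $\alpha<\omega_1$ the restriction of $F$ to $2^{\alpha}$ is Borel, with $\mathcal P([\omega]^{<\omega})$ identified with $2^\omega$), there is a function $g$ from $\omega_1$ to the set of infinite block sequences such that for every $f:\omega_1\to 2$ the set $\{\alpha<\omega_1 : F(f\restriction\alpha)\text{ is FU-reaped by }g(\alpha)\}$ is stationary. An ultrafilter $u$ on $[\omega]^{<\omega}$ is a union ultrafilter if for every $A\in u$ there is an infinite pairwise disjoint $X\subseteq[\omega]^{<\omega}$ with $\mathrm{FU}(X)\subseteq A$ and $\mathrm{FU}(X)\in u$; it is an ordered-union ultrafilter if for every $A\in u$ there is an infinite ordered $X$ with $\mathrm{FU}(X)\subseteq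 A$ and $\mathrm{FU}(X)\in u$. A union ultrafilter $u$ is stable if for every countable collection $\{X_n:n<\omega\}$ of pairwise disjoint families with $\mathrm{FU}(X_n)\in u$ for all $n$, there is a pairwise disjoint $X$ with $\mathrm{FU}(X)\in u$ and $X\subseteq^*\mathrm{FU}(X_n)$ for all $n$. The character of an ultrafilter is the least cardinality of a base for it. *)

theory Defs
  imports "HOL-Analysis.Analysis" "HOL-Library.Disjoint_Sets"
begin

unbundle cardinal_syntax

lemma Well_order_cardSuc_natLeq: "Well_order (cardSuc natLeq)"
  using cardSuc_Card_order[OF natLeq_Card_order] card_order_on_well_order_on by blast

lemma infinite_Field_cardSuc_natLeq: "infinite (Field (cardSuc natLeq))"
  using cardSuc_finite[OF natLeq_Card_order] by (simp add: Field_natLeq)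

typedef omega1 = "Field (cardSuc natLeq)"
  using infinite_Field_cardSuc_natLeq by (metis ex_in_conv finite.emptyI)

instantiation omega1 :: wellorder
begin

definition less_eq_omega1 :: "omega1 \<Rightarrow> omega1 \<Rightarrow> bool" where
  "(a :: omega1) \<le> b \<longleftrightarrow> (Rep_omega1 a, Rep_omega1 b) \<in> cardSuc natLeq"

definition less_omega1 :: "omega1 \<Rightarrow> omega1 \<Rightarrow> bool" where
  "(a :: omega1) < b \<longleftrightarrow> a \<le> b \<and> a \<noteq> b"

instance
proof
  have lin: "refl_on (Field (cardSuc natLeq)) (cardSuc natLeq)" "trans (cardSuc natLeq)"
    "antisym (cardSuc natLeq)" "total_on (Field (cardSuc natLeq)) (cardSuc natLeq)"
    and wf: "wf (cardSuc natLeq - Id)"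
    using Well_order_cardSuc_natLeq
    by (auto simp: well_order_on_def linear_order_on_def partial_order_on_def preorder_on_def)
  show refl: "x \<le> x" for x :: omega1
    using lin(1) Rep_omega1[of x] by (auto simp: less_eq_omega1_def refl_on_def)
  show "x \<le> z" if "x \<le> y" "y \<le> z" for x y z :: omega1
    using that lin(2) by (auto simp: less_eq_omega1_def elim: transE)
  show antisym: "x = y" if "x \<le> y" "y \<le> x" for x y :: omega1
    using that lin(3) by (auto simp: less_eq_omega1_def Rep_omega1_inject dest: antisymD)
  show "x < y \<longleftrightarrow> x \<le> y \<and> \<not> y \<le> x" for x y :: omega1
    using refl antisym by (auto simp: less_omega1_def)
  show "x \<le> y \<or> y \<le> x" for x y :: omega1
    using lin(4) Rep_omega1[of x] Rep_omega1[of y] refl[of x]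
    by (cases "x = y") (auto simp: less_eq_omega1_def total_on_def Rep_omega1_inject)
  show "P a" if step: "\<And>x. (\<And>y. y < x \<Longrightarrow> P y) \<Longrightarrow> P x" for P and a :: omega1
  proof -
    have "wf {(x, y). x < (y :: omega1)}"
      by (rule wf_subset[OF wf_inv_image[OF wf, of Rep_omega1]])
        (auto simp: less_omega1_def less_eq_omega1_def inv_image_def Rep_omega1_inject)
    then show ?thesis
      by (induction a rule: wf_induct_rule) (use step in auto)
  qed
qed

end

lemma card_of_UNIV_omega1: "|UNIV :: omega1 set| =o cardSuc natLeq"
proof -
  have "bij_betw Rep_omega1 UNIV (Field (cardSuc natLeq))"
    using type_definition.Rep_range[OF type_definition_omega1]
    by (auto simp: bij_betw_def inj_on_def Rep_omega1_inject)
  then have "|UNIV :: omega1 set| =o |Field (cardSuc natLeq)|"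
    using card_of_ordIso by blast
  then show ?thesis
    using card_of_Field_ordIso[OF cardSuc_Card_order[OF natLeq_Card_order]]
      ordIso_transitive by blast
qed

definition club :: "omega1 set \<Rightarrow> bool" where
  "club C \<longleftrightarrow>
     (\<forall>\<alpha>. \<exists>\<beta>\<in>C. \<alpha> < \<beta>) \<and>
     (\<forall>\<alpha>. (\<exists>\<beta>. \<beta> < \<alpha>) \<and> (\<forall>\<beta><\<alpha>. \<exists>\<gamma>\<in>C. \<beta> < \<gamma> \<and> \<gamma> < \<alpha>) \<longrightarrow> \<alpha> \<in> C)"

definition stationary :: "omega1 set \<Rightarrow> bool" where
  "stationary S \<longleftrightarrow> (\<forall>C. club C \<longrightarrow> S \<inter> C \<noteq> {})"

abbreviation fin_sets :: "nat set set" where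
  "fin_sets \<equiv> Fpow UNIV"

definition FU :: "nat set set \<Rightarrow> nat set set" where
  "FU X = {\<Union>F |F. F \<in> Fpow X - {{}}}"

text \<open>The maximum and minimum of a member of an ordered family are required to exist, so the empty
  set is not allowed as a member.\<close>

definition ordered_family :: "nat set set \<Rightarrow> bool" where
  "ordered_family X \<longleftrightarrow> X \<subseteq> fin_sets \<and> {} \<notin> X \<and>
     (\<forall>x\<in>X. \<forall>y\<in>X. x \<noteq> y \<longrightarrow> Max x < Min y \<or> Max y < Min x)"

definition pairwise_disjoint_family :: "nat set set \<Rightarrow> bool" where
  "pairwise_disjoint_family X \<longleftrightarrow> X \<subseteq> fin_sets \<and> disjoint X"

definition FU_reaped :: "nat set set \<Rightarrow> nat set set \<Rightarrow> bool" where
  "FU_reaped A X \<longleftrightarrow> FU X \<subseteq> A \<or> FU X \<inter> A = {}"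

text \<open>The space \<open>2\<^sup>I\<close>; its points are the functions on \<open>I\<close> that are \<open>undefined\<close> outside \<open>I\<close>.\<close>

definition cantor_space :: "'i set \<Rightarrow> ('i \<Rightarrow> bool) topology" where
  "cantor_space I = product_topology (\<lambda>_. discrete_topology UNIV) I"

definition borel_algebra :: "'a topology \<Rightarrow> 'a measure" where
  "borel_algebra T = sigma (topspace T) {U. openin T U}"

text \<open>A function on \<open>2\<^bsup><\<omega>\<^sub>1\<^esup>\<close>, the disjoint union of the levels \<open>2\<^sup>\<alpha>\<close>, is given by its
  restrictions \<open>F \<alpha>\<close> to the levels. The power set of \<open>fin_sets\<close> carries the topology of
  \<open>cantor_space fin_sets\<close> through characteristic functions.\<close>

definition borel_on_levels ::
    "(omega1 \<Rightarrow> (omega1 \<Rightarrow> bool) \<Rightarrow> nat set set) \<Rightarrow> bool" where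
  "borel_on_levels F \<longleftrightarrow>
     (\<forall>\<alpha>. F \<alpha> \<in> topspace (cantor_space {..<\<alpha>}) \<rightarrow> Pow fin_sets \<and>
          (\<lambda>s. \<lambda>x\<in>fin_sets. x \<in> F \<alpha> s)
            \<in> borel_algebra (cantor_space {..<\<alpha>}) \<rightarrow>\<^sub>M borel_algebra (cantor_space fin_sets))"

definition diamond_hom_H :: bool where
  "diamond_hom_H \<longleftrightarrow>
     (\<forall>F. borel_on_levels F \<longrightarrow>
       (\<exists>g :: omega1 \<Rightarrow> nat set set.
          (\<forall>\<alpha>. infinite (g \<alpha>) \<and> ordered_family (g \<alpha>)) \<and>
          (\<forall>f :: omega1 \<Rightarrow> bool. stationary {\<alpha>. FU_reaped (F \<alpha> (restrict f {..<\<alpha>})) (g \<alpha>)})))"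

definition ultrafilter_on :: "'a set \<Rightarrow> 'a set set \<Rightarrow> bool" where
  "ultrafilter_on S u \<longleftrightarrow>
     u \<subseteq> Pow S \<and> S \<in> u \<and> {} \<notin> u \<and>
     (\<forall>A\<in>u. \<forall>B\<in>u. A \<inter> B \<in> u) \<and>
     (\<forall>A\<in>u. \<forall>B. A \<subseteq> B \<and> B \<subseteq> S \<longrightarrow> B \<in> u) \<and>
     (\<forall>A. A \<subseteq> S \<longrightarrow> A \<in> u \<or> S - A \<in> u)"

definition union_ultrafilter :: "nat set set set \<Rightarrow> bool" where
  "union_ultrafilter u \<longleftrightarrow> ultrafilter_on fin_sets u \<and>
     (\<forall>A\<in>u. \<exists>X. infinite X \<and> pairwise_disjoint_family X \<and> FU X \<subseteq> A \<and> FU X \<in> u)"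

definition ordered_union_ultrafilter :: "nat set set set \<Rightarrow> bool" where
  "ordered_union_ultrafilter u \<longleftrightarrow> ultrafilter_on fin_sets u \<and>
     (\<forall>A\<in>u. \<exists>X. infinite X \<and> ordered_family X \<and> FU X \<subseteq> A \<and> FU X \<in> u)"

definition stable_union_ultrafilter :: "nat set set set \<Rightarrow> bool" where
  "stable_union_ultrafilter u \<longleftrightarrow> union_ultrafilter u \<and>
     (\<forall>Y :: nat \<Rightarrow> nat set set. (\<forall>n. pairwise_disjoint_family (Y n) \<and> FU (Y n) \<in> u) \<longrightarrow>
        (\<exists>X. pairwise_disjoint_family X \<and> FU X \<in> u \<and> (\<forall>n. finite (X - FU (Y n)))))"

definition filter_base :: "'a set set \<Rightarrow> 'a set set \<Rightarrow> bool" where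
  "filter_base u B \<longleftrightarrow> B \<subseteq> u \<and> (\<forall>A\<in>u. \<exists>b\<in>B. b \<subseteq> A)"

definition has_character :: "'a set set \<Rightarrow> 'c rel \<Rightarrow> bool" where
  "has_character u \<kappa> \<longleftrightarrow>
     (\<exists>B. filter_base u B \<and> |B| =o \<kappa>) \<and> (\<forall>B. filter_base u B \<longrightarrow> \<kappa> \<le>o |B| )"

end

theory Submission
  imports Defs "HOL-Library.Countable_Set_Type"
begin

text \<open>Block sequences \<open>X \<alpha>\<close>, \<open>\<alpha> < \<omega>\<^sub>1\<close>, are built by recursion so that \<open>X \<alpha>\<close> is almost
  contained in \<open>FU (X \<xi>)\<close> for all \<open>\<xi> < \<alpha>\<close>. At stage \<open>\<alpha>\<close> a block sequence
  \<open>y\<^sub>0 < y\<^sub>1 < \<dots>\<close> diagonalising the sets \<open>FU (X \<xi>)\<close>, \<open>\<xi> < \<alpha>\<close>, is chosen in a Borel way, and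
  \<open>X \<alpha>\<close> consists of the unions of the \<open>y\<^sub>i\<close> with \<open>i \<in> x\<close>, for \<open>x \<in> g \<alpha>\<close>. The diamond
  principle is applied to the Borel function that decodes a point of \<open>2\<^sup>\<alpha>\<close> into the sets
  \<open>FU (X \<xi>)\<close> and a set \<open>A\<close> and returns the set of all \<open>x\<close> for which the union of the \<open>y\<^sub>i\<close>
  with \<open>i \<in> x\<close> lies in \<open>A\<close>: whenever \<open>g \<alpha>\<close> reaps this set, \<open>FU (X \<alpha>)\<close> decides \<open>A\<close>.
  For a fixed \<open>A\<close>, the levels \<open>\<alpha>\<close> at which the coding is closed form a club, so some \<open>\<alpha>\<close> does it.
  A countable base is impossible, since some set splits countably many infinite sets.\<close>

section \<open>The ordinal \<open>\<omega>\<^sub>1\<close>\<close>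

lemma countable_lessThan_omega1: "countable {..<\<alpha> :: omega1}"
proof -
  have "Rep_omega1 ` {..<\<alpha>} \<subseteq> underS (cardSuc natLeq) (Rep_omega1 \<alpha>)"
    by (auto simp: underS_def less_omega1_def less_eq_omega1_def Rep_omega1_inject)
  moreover have "|underS (cardSuc natLeq) (Rep_omega1 \<alpha>)| <o cardSuc natLeq"
    by (rule card_of_underS[OF cardSuc_Card_order[OF natLeq_Card_order] Rep_omega1])
  ultimately have "|Rep_omega1 ` {..<\<alpha>}| <o cardSuc natLeq"
    using card_of_mono1 ordLeq_ordLess_trans by blast
  then have "|Rep_omega1 ` {..<\<alpha>}| \<le>o natLeq"
    using cardSuc_ordLeq_ordLess[OF natLeq_Card_order card_of_Card_order] by blast
  then have "countable (Rep_omega1 ` {..<\<alpha>})"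
    by (simp add: countable_card_le_natLeq)
  then show ?thesis
    by (rule countable_image_inj_on) (simp add: inj_on_def Rep_omega1_inject)
qed

lemma countable_if_less_cardSuc_natLeq:
  assumes "\<not> cardSuc natLeq \<le>o |A|"
  shows "countable A"
proof -
  have "|A| <o cardSuc natLeq"
    using assms card_of_Well_order Well_order_cardSuc_natLeq not_ordLeq_iff_ordLess by blast
  then show ?thesis
    using cardSuc_ordLeq_ordLess[OF natLeq_Card_order card_of_Card_order] countable_card_le_natLeq
    by blast
qed

lemma uncountable_omega1: "uncountable (UNIV :: omega1 set)"
proof
  assume "countable (UNIV :: omega1 set)"
  then have "|UNIV :: omega1 set| \<le>o natLeq"
    by (simp add: countable_card_le_natLeq)
  then have "cardSuc natLeq \<le>o natLeq"
    using card_of_UNIV_omega1 ordIso_symmetric ordIso_ordLeq_trans by blast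
  then show False
    using cardSuc_greater[OF natLeq_Card_order] not_ordLess_ordLeq by blast
qed

text \<open>Regularity of \<open>omega1\<close>: if a countable \<open>A\<close> were unbounded, the
  countable initial segments up to its members would cover the whole ordinal.\<close>

lemma countable_bounded_omega1:
  assumes "countable (A :: omega1 set)"
  shows "\<exists>\<beta>. \<forall>\<alpha>\<in>A. \<alpha> < \<beta>"
proof (rule ccontr)
  assume "\<nexists>\<beta>. \<forall>\<alpha>\<in>A. \<alpha> < \<beta>"
  then have "UNIV = (\<Union>\<alpha>\<in>A. insert \<alpha> {..<\<alpha>})"
    by (auto simp: not_less) (metis le_less)
  moreover have "countable (\<Union>\<alpha>\<in>A. insert \<alpha> {..<\<alpha>})"
    using assms countable_lessThan_omega1 by auto
  ultimately show False
    using uncountable_omega1 by simp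
qed

lemma countable_card_of_le_omega1:
  assumes "countable B"
  shows "|B| \<le>o |UNIV :: omega1 set|"
proof -
  have "|B| \<le>o natLeq" using assms by (simp add: countable_card_le_natLeq)
  also have "natLeq \<le>o cardSuc natLeq" by (rule cardSuc_ordLeq[OF natLeq_Card_order])
  also have "cardSuc natLeq =o |UNIV :: omega1 set|"
    by (rule ordIso_symmetric[OF card_of_UNIV_omega1])
  finally show ?thesis .
qed

lemma card_of_omega1_Times_countable:
  assumes "countable B" "B \<noteq> {}"
  shows "|(UNIV :: omega1 set) \<times> B| =o |UNIV :: omega1 set|"
proof (rule card_of_Times_infinite_simps(1)[OF _ assms(2)])
  show "infinite (UNIV :: omega1 set)"
    using uncountable_omega1 countable_finite by blast
  show "|B| \<le>o |UNIV :: omega1 set|"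
    by (rule countable_card_of_le_omega1[OF assms(1)])
qed

text \<open>Iterating a strict bound for the values of \<open>h\<close> gives unboundedness, and
  being closed under \<open>h\<close> passes to limits. The clause
  \<open>\<exists>\<beta>. \<beta> < \<alpha>\<close> keeps 0 out, so \<open>{..<\<alpha>}\<close>
  is nonempty throughout the club.\<close>

lemma club_closed_under:
  fixes h :: "omega1 \<Rightarrow> 'i \<Rightarrow> omega1"
  assumes "countable I"
  shows "club {\<alpha>. (\<exists>\<beta>. \<beta> < \<alpha>) \<and> (\<forall>\<xi><\<alpha>. \<forall>i\<in>I. h \<xi> i < \<alpha>)}" (is "club ?C")
proof -
  have "\<exists>\<beta>. \<alpha> < \<beta> \<and> (\<forall>\<xi>\<le>\<alpha>. \<forall>i\<in>I. h \<xi> i < \<beta>)" for \<alpha>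
  proof -
    have "{..\<alpha>} = insert \<alpha> {..<\<alpha>}" by auto
    then have "countable {..\<alpha>}"
      by (metis countable_insert countable_lessThan_omega1)
    then have "countable (insert \<alpha> (\<Union>\<xi>\<in>{..\<alpha>}. h \<xi> ` I))"
      using assms by auto
    from countable_bounded_omega1[OF this] show ?thesis by auto
  qed
  then obtain nxt where nxt: "\<And>\<alpha>. \<alpha> < nxt \<alpha>" "\<And>\<alpha> \<xi> i. \<xi> \<le> \<alpha> \<Longrightarrow> i \<in> I \<Longrightarrow> h \<xi> i < nxt \<alpha>"
    by metis
  have "\<exists>\<beta>\<in>?C. \<alpha> < \<beta>" for \<alpha>
  proof -
    define a where "a n = (nxt ^^ n) \<alpha>" for n
    \<comment> \<open>Leastness makes \<beta> the limit of the iterates: any \<xi> < \<beta> is at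
      most some \<open>a n\<close>, so its \<open>h\<close>-values are already below
      \<open>a (Suc n)\<close>.\<close>
    define \<beta> where "\<beta> = (LEAST \<beta>. \<forall>n. a n < \<beta>)"
    have "\<exists>\<beta>. \<forall>n. a n < \<beta>"
      using countable_bounded_omega1[of "range a"] by auto
    then have below: "a n < \<beta>" for n
      unfolding \<beta>_def using LeastI_ex[of "\<lambda>\<beta>. \<forall>n. a n < \<beta>"] by blast
    have "h \<xi> i < \<beta>" if "\<xi> < \<beta>" "i \<in> I" for \<xi> i
    proof -
      obtain n where "\<xi> \<le> a n"
        using not_less_Least[of \<xi> "\<lambda>\<beta>. \<forall>n. a n < \<beta>"] \<open>\<xi> < \<beta>\<close> unfolding \<beta>_def
        by (meson not_le)
      then have "h \<xi> i < a (Suc n)"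
        using nxt(2) that(2) by (simp add: a_def)
      then show ?thesis
        using below order.strict_trans by blast
    qed
    moreover have "\<alpha> < \<beta>"
      using below[of 0] by (simp add: a_def)
    ultimately show ?thesis by blast
  qed
  moreover have "\<alpha> \<in> ?C"
    if "\<exists>\<beta>. \<beta> < \<alpha>" and lim: "\<forall>\<beta><\<alpha>. \<exists>\<gamma>\<in>?C. \<beta> < \<gamma> \<and> \<gamma> < \<alpha>" for \<alpha>
  proof -
    have "h \<xi> i < \<alpha>" if "\<xi> < \<alpha>" "i \<in> I" for \<xi> i
    proof -
      obtain \<gamma> where "\<gamma> \<in> ?C" "\<xi> < \<gamma>" "\<gamma> < \<alpha>"
        using lim \<open>\<xi> < \<alpha>\<close> by blast
      then show ?thesis
        using \<open>i \<in> I\<close> by (auto intro: order.strict_trans)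
    qed
    then show ?thesis using that by blast
  qed
  ultimately show ?thesis
    unfolding club_def by blast
qed

section \<open>Measurability\<close>

lemma topspace_cantor_space: "topspace (cantor_space I) = (\<Pi>\<^sub>E i\<in>I. UNIV)"
  by (simp add: cantor_space_def)

lemma space_borel_algebra: "space (borel_algebra T) = topspace T"
  by (simp add: borel_algebra_def space_measure_of_conv)

lemma sets_borel_algebra: "sets (borel_algebra T) = sigma_sets (topspace T) {U. openin T U}"
  unfolding borel_algebra_def by (rule sets_measure_of) (auto dest: openin_subset)

lemma pred_cantor_space_component:
  assumes "i \<in> I"
  shows "Measurable.pred (borel_algebra (cantor_space I)) (\<lambda>s. s i)"
proof -
  have "openin (cantor_space I) {s \<in> topspace (cantor_space I). s i \<in> {True}}"
    unfolding cantor_space_def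
    by (rule openin_continuous_map_preimage[OF continuous_map_product_projection[OF assms]]) simp
  then show ?thesis
    by (auto simp: pred_def sets_borel_algebra space_borel_algebra)
qed

text \<open>A basic box restricts finitely many coordinates, so around each of its points it
  contains a cylinder with finite support \<open>J\<close>, where \<open>T\<close> records the
  coordinates that are true. A countable \<open>I\<close> has only countably many such
  pairs.\<close>

lemma cantor_space_open_countable_union:
  assumes "countable I" "openin (cantor_space I) U"
  obtains P where "countable P" "P \<subseteq> Fpow I \<times> Fpow I"
    "U = (\<Union>(J, T)\<in>P. {h \<in> \<Pi>\<^sub>E i\<in>I. UNIV. \<forall>i\<in>J. h i \<longleftrightarrow> i \<in> T})"
proof
  define cyl where "cyl J T = {h \<in> \<Pi>\<^sub>E i\<in>I. UNIV. \<forall>i\<in>J. h i \<longleftrightarrow> i \<in> T}" for J T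
  define P where "P = {(J, T) \<in> Fpow I \<times> Fpow I. cyl J T \<subseteq> U}"
  show "P \<subseteq> Fpow I \<times> Fpow I"
    by (auto simp: P_def)
  then show "countable P"
    by (rule countable_subset) (use assms(1) in \<open>auto intro: countable_Fpow\<close>)
  have "f \<in> (\<Union>(J, T)\<in>P. cyl J T)" if "f \<in> U" for f
  proof -
    obtain V where V: "finite {i \<in> I. V i \<noteq> UNIV}" "f \<in> Pi\<^sub>E I V" "Pi\<^sub>E I V \<subseteq> U"
      using assms(2) \<open>f \<in> U\<close>
      unfolding cantor_space_def openin_product_topology_alt topspace_discrete_topology by meson
    define J where "J = {i \<in> I. V i \<noteq> UNIV}"
    have f: "f \<in> cyl J {i \<in> J. f i}"
      using V(2) by (auto simp: cyl_def PiE_def)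
    have "h \<in> Pi\<^sub>E I V" if "h \<in> cyl J {i \<in> J. f i}" for h
    proof (rule PiE_I)
      fix i assume "i \<in> I"
      show "h i \<in> V i"
      proof (cases "i \<in> J")
        case True
        then have "h i = f i" using that by (auto simp: cyl_def)
        then show ?thesis using V(2) \<open>i \<in> I\<close> by (simp add: PiE_mem)
      next
        case False
        then show ?thesis using \<open>i \<in> I\<close> by (simp add: J_def)
      qed
    next
      fix i assume "i \<notin> I"
      then show "h i = undefined" using that by (auto simp: cyl_def PiE_def extensional_def)
    qed
    then have "cyl J {i \<in> J. f i} \<subseteq> U" using V(3) by blast
    moreover have "finite J" "J \<subseteq> I" using V(1) by (auto simp: J_def)
    ultimately have "(J, {i \<in> J. f i}) \<in> P" by (auto simp: P_def Fpow_def)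
    then show ?thesis using f by blast
  qed
  then show "U = (\<Union>(J, T)\<in>P. {h \<in> \<Pi>\<^sub>E i\<in>I. UNIV. \<forall>i\<in>J. h i \<longleftrightarrow> i \<in> T})"
    unfolding cyl_def[symmetric] by (fastforce simp: P_def)
qed

text \<open>The preimage of an open set is a countable union of finite Boolean combinations of
  coordinate predicates, so Borel measurability can be checked coordinate by coordinate.\<close>

lemma measurable_into_cantor_space:
  assumes "countable I" "f \<in> space M \<rightarrow> topspace (cantor_space I)"
    and comp: "\<And>i. i \<in> I \<Longrightarrow> Measurable.pred M (\<lambda>s. f s i)"
  shows "f \<in> M \<rightarrow>\<^sub>M borel_algebra (cantor_space I)"
proof (rule measurable_sigma_sets[OF sets_borel_algebra _ assms(2)])
  show "{U. openin (cantor_space I) U} \<subseteq> Pow (topspace (cantor_space I))"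
    by (auto dest: openin_subset)
  fix U assume "U \<in> {U. openin (cantor_space I) U}"
  then have "openin (cantor_space I) U" by simp
  then obtain P where P: "countable P" "P \<subseteq> Fpow I \<times> Fpow I"
    "U = (\<Union>(J, T)\<in>P. {h \<in> \<Pi>\<^sub>E i\<in>I. UNIV. \<forall>i\<in>J. h i \<longleftrightarrow> i \<in> T})"
    by (rule cantor_space_open_countable_union[OF assms(1)])
  have "f -` U \<inter> space M = (\<Union>(J, T)\<in>P. {s \<in> space M. \<forall>i\<in>J. f s i \<longleftrightarrow> i \<in> T})"
    using assms(2) unfolding P(3) topspace_cantor_space by fastforce
  also have "\<dots> \<in> sets M"
  proof (intro sets.countable_UN'' P(1))
    fix p assume "p \<in> P"
    then obtain J T where p: "p = (J, T)" "finite J" "J \<subseteq> I"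
      using P(2) by (auto simp: Fpow_def)
    have "Measurable.pred M (\<lambda>s. \<forall>i\<in>J. f s i \<longleftrightarrow> i \<in> T)"
      using p(2,3) comp by (intro pred_intros_finite(3) pred_intros_logic) auto
    then show "(case p of (J, T) \<Rightarrow> {s \<in> space M. \<forall>i\<in>J. f s i \<longleftrightarrow> i \<in> T}) \<in> sets M"
      by (simp add: p pred_def)
  qed
  finally show "f -` U \<inter> space M \<in> sets M" .
qed

section \<open>Block sequences\<close>

lemma countable_fin_sets: "countable fin_sets"
  by (simp add: countable_Fpow)

lemma ordered_family_iff:
  "ordered_family X \<longleftrightarrow> X \<subseteq> fin_sets \<and> {} \<notin> X \<and>
     (\<forall>x\<in>X. \<forall>y\<in>X. x \<noteq> y \<longrightarrow> (\<forall>a\<in>x. \<forall>b\<in>y. a < b) \<or> (\<forall>a\<in>y. \<forall>b\<in>x. a < b))"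
proof -
  have "Max x < Min y \<longleftrightarrow> (\<forall>a\<in>x. \<forall>b\<in>y. a < b)"
    if "X \<subseteq> fin_sets" "{} \<notin> X" "x \<in> X" "y \<in> X" for x y
  proof -
    have "finite x" "x \<noteq> {}" "finite y" "y \<noteq> {}"
      using that by (auto simp: Fpow_def)
    then show ?thesis by (auto simp: Max_less_iff Min_gr_iff)
  qed
  then show ?thesis
    unfolding ordered_family_def by (intro conj_cong ball_cong imp_cong disj_cong refl) auto
qed

lemma ordered_family_imp_pairwise_disjoint:
  assumes "ordered_family X"
  shows "pairwise_disjoint_family X"
  unfolding pairwise_disjoint_family_def disjoint_def
proof (intro conjI ballI impI)
  show "X \<subseteq> fin_sets" using assms by (simp add: ordered_family_def)
  fix x y assume "x \<in> X" "y \<in> X" "x \<noteq> y"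
  then have "(\<forall>a\<in>x. \<forall>b\<in>y. a < b) \<or> (\<forall>a\<in>y. \<forall>b\<in>x. a < b)"
    using assms by (auto simp: ordered_family_iff)
  then show "x \<inter> y = {}" by auto
qed

text \<open>Tails turn almost inclusion into inclusion: discarding an initial part removes any
  finite set of exceptional blocks.\<close>

definition tail :: "nat \<Rightarrow> nat set set \<Rightarrow> nat set set" where
  "tail m X = {x \<in> X. \<forall>b\<in>x. m < b}"

lemma tail_subset: "tail m X \<subseteq> X"
  by (auto simp: tail_def)

lemma ordered_family_subset: "ordered_family X \<Longrightarrow> Y \<subseteq> X \<Longrightarrow> ordered_family Y"
  unfolding ordered_family_def by (meson order_trans subsetD)

text \<open>Every discarded block meets \<open>{..m}\<close>, and disjoint blocks have different
  nonempty traces there.\<close>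

lemma finite_diff_tail:
  assumes "ordered_family X"
  shows "finite (X - tail m X)"
proof (rule inj_on_finite)
  show "(\<lambda>x. x \<inter> {..m}) ` (X - tail m X) \<subseteq> Pow {..m}" by auto
  show "inj_on (\<lambda>x. x \<inter> {..m}) (X - tail m X)"
  proof (rule inj_onI, rule ccontr)
    fix x y assume xy: "x \<in> X - tail m X" "y \<in> X - tail m X" "x \<inter> {..m} = y \<inter> {..m}" "x \<noteq> y"
    then have "x \<inter> y = {}"
      using ordered_family_imp_pairwise_disjoint[OF assms]
      by (auto simp: pairwise_disjoint_family_def disjoint_def)
    then have "x \<inter> {..m} = {}" using xy(3) by blast
    then show False using xy(1) by (auto simp: tail_def not_less)
  qed
qed simp

lemma infinite_tail:
  assumes "ordered_family X" "infinite X"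
  shows "infinite (tail m X)"
proof
  assume "finite (tail m X)"
  then have "finite ((X - tail m X) \<union> tail m X)"
    using finite_diff_tail[OF assms(1)] by blast
  then have "finite X" by (rule finite_subset[rotated]) auto
  then show False using assms(2) by simp
qed

section \<open>Finite unions\<close>

lemma FU_I: "F \<subseteq> X \<Longrightarrow> finite F \<Longrightarrow> F \<noteq> {} \<Longrightarrow> \<Union>F \<in> FU X"
  unfolding FU_def Fpow_def by (intro CollectI exI[of _ F]) simp

lemma FU_E:
  assumes "z \<in> FU X"
  obtains F where "F \<subseteq> X" "finite F" "F \<noteq> {}" "z = \<Union>F"
proof -
  from assms obtain F where "z = \<Union>F" "F \<in> Fpow X - {{}}"
    unfolding FU_def by (elim CollectE exE conjE)
  then show ?thesis using that[of F] by (simp add: Fpow_def)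
qed

lemma subset_FU: "X \<subseteq> FU X"
proof
  fix x assume "x \<in> X"
  then show "x \<in> FU X" using FU_I[of "{x}" X] by simp
qed

lemma FU_mono:
  assumes "X \<subseteq> Y"
  shows "FU X \<subseteq> FU Y"
proof
  fix z assume "z \<in> FU X"
  then obtain F where F: "F \<subseteq> X" "finite F" "F \<noteq> {}" "z = \<Union>F" by (rule FU_E)
  show "z \<in> FU Y" unfolding F(4) by (rule FU_I) (use F assms in auto)
qed

lemma FU_subset_fin_sets:
  assumes "X \<subseteq> fin_sets"
  shows "FU X \<subseteq> fin_sets"
proof
  fix z assume "z \<in> FU X"
  then obtain F where "F \<subseteq> X" "finite F" "z = \<Union>F" by (rule FU_E)
  moreover from this have "\<forall>x\<in>F. finite x" using assms by (auto simp: Fpow_def)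
  ultimately show "z \<in> fin_sets" by (simp add: Fpow_def)
qed

lemma FU_closed_Union:
  assumes "F \<subseteq> FU X" "finite F" "F \<noteq> {}"
  shows "\<Union>F \<in> FU X"
proof -
  have "\<forall>z\<in>F. \<exists>G. G \<subseteq> X \<and> finite G \<and> G \<noteq> {} \<and> z = \<Union>G"
    using assms(1) by (meson FU_E subsetD)
  then obtain G where G: "\<And>z. z \<in> F \<Longrightarrow> G z \<subseteq> X \<and> finite (G z) \<and> G z \<noteq> {}" "\<And>z. z \<in> F \<Longrightarrow> \<Union>(G z) = z"
    by metis
  have "\<Union>(\<Union>(G ` F)) \<in> FU X"
    by (rule FU_I) (use G(1) assms(2,3) in auto)
  moreover have "\<Union>(\<Union>(G ` F)) = (\<Union>z\<in>F. \<Union>(G z))" by blast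
  moreover have "\<dots> = \<Union>F" using G(2) by simp
  ultimately show ?thesis by simp
qed

lemma FU_subset_FU:
  assumes "X \<subseteq> FU Y"
  shows "FU X \<subseteq> FU Y"
proof
  fix z assume "z \<in> FU X"
  then obtain F where F: "F \<subseteq> X" "finite F" "F \<noteq> {}" "z = \<Union>F" by (rule FU_E)
  show "z \<in> FU Y" unfolding F(4) by (rule FU_closed_Union) (use F assms in auto)
qed

text \<open>A union lies beyond \<open>m\<close> exactly when all its parts do. Inclusions between
  sets \<open>FU (tail m X)\<close> thus reduce to inclusions between sets
  \<open>FU X\<close>.\<close>

lemma FU_tail: "FU (tail m X) = {z \<in> FU X. \<forall>b\<in>z. m < b}"
proof
  have "\<forall>b\<in>z. m < b" if "z \<in> FU (tail m X)" for z
    using that by (rule FU_E) (auto simp: tail_def)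
  then show "FU (tail m X) \<subseteq> {z \<in> FU X. \<forall>b\<in>z. m < b}"
    using FU_mono[OF tail_subset] by blast
  show "{z \<in> FU X. \<forall>b\<in>z. m < b} \<subseteq> FU (tail m X)"
  proof
    fix z assume "z \<in> {z \<in> FU X. \<forall>b\<in>z. m < b}"
    then have "z \<in> FU X" and m: "\<forall>b\<in>z. m < b" by auto
    from this(1) obtain F where F: "F \<subseteq> X" "finite F" "F \<noteq> {}" "z = \<Union>F"
      by (rule FU_E)
    then have "F \<subseteq> tail m X" using m by (auto simp: tail_def)
    then show "z \<in> FU (tail m X)"
      unfolding F(4) using F by (intro FU_I)
  qed
qed

section \<open>Merging the blocks of a sequence along index sets\<close>

definition block_seq :: "(nat \<Rightarrow> nat set) \<Rightarrow> bool" where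
  "block_seq y \<longleftrightarrow> (\<forall>n. finite (y n) \<and> y n \<noteq> {}) \<and> (\<forall>m n. m < n \<longrightarrow> (\<forall>a\<in>y m. \<forall>b\<in>y n. a < b))"

text \<open>Merging commutes with unions of index sets. This carries a homogeneity property of
  \<open>G\<close> over to the family of merged blocks.\<close>

lemma FU_image_merge: "FU ((\<lambda>x. \<Union>(y ` x)) ` G) = (\<lambda>x. \<Union>(y ` x)) ` FU G"
proof
  show "FU ((\<lambda>x. \<Union>(y ` x)) ` G) \<subseteq> (\<lambda>x. \<Union>(y ` x)) ` FU G"
  proof
    fix z assume "z \<in> FU ((\<lambda>x. \<Union>(y ` x)) ` G)"
    then obtain F where F: "F \<subseteq> (\<lambda>x. \<Union>(y ` x)) ` G" "finite F" "F \<noteq> {}" "z = \<Union>F"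
      by (rule FU_E)
    obtain H where "H \<subseteq> G" "finite H" "F = (\<lambda>x. \<Union>(y ` x)) ` H"
      using finite_subset_image[OF F(2,1)] by auto
    moreover from this have "z = \<Union>(y ` \<Union>H)" using F by auto
    moreover have "\<Union>H \<in> FU G" using calculation F(3) by (intro FU_I) auto
    ultimately show "z \<in> (\<lambda>x. \<Union>(y ` x)) ` FU G" by blast
  qed
  show "(\<lambda>x. \<Union>(y ` x)) ` FU G \<subseteq> FU ((\<lambda>x. \<Union>(y ` x)) ` G)"
  proof
    fix z assume "z \<in> (\<lambda>x. \<Union>(y ` x)) ` FU G"
    then obtain x where x: "x \<in> FU G" "z = \<Union>(y ` x)" by blast
    from x(1) obtain H where "H \<subseteq> G" "finite H" "H \<noteq> {}" "x = \<Union>H" by (rule FU_E)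
    with x(2) have H: "H \<subseteq> G" "finite H" "H \<noteq> {}" "z = \<Union>(y ` \<Union>H)" by simp_all
    then have "z = \<Union>((\<lambda>x. \<Union>(y ` x)) ` H)" by auto
    also have "\<dots> \<in> FU ((\<lambda>x. \<Union>(y ` x)) ` G)"
      by (rule FU_I) (use H in auto)
    finally show "z \<in> FU ((\<lambda>x. \<Union>(y ` x)) ` G)" .
  qed
qed

lemma ordered_family_merge:
  assumes y: "block_seq y" and G: "ordered_family G"
  shows "ordered_family ((\<lambda>x. \<Union>(y ` x)) ` G)"
  unfolding ordered_family_iff
proof (intro conjI ballI impI)
  have fin: "finite x" "x \<noteq> {}" if "x \<in> G" for x
    using G that by (auto simp: ordered_family_def Fpow_def)
  show "(\<lambda>x. \<Union>(y ` x)) ` G \<subseteq> fin_sets"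
    using y fin by (auto simp: Fpow_def block_seq_def)
  show "{} \<notin> (\<lambda>x. \<Union>(y ` x)) ` G"
    using y fin by (fastforce simp: block_seq_def)
  fix u v assume "u \<in> (\<lambda>x. \<Union>(y ` x)) ` G" "v \<in> (\<lambda>x. \<Union>(y ` x)) ` G" "u \<noteq> v"
  then obtain p q where pq: "p \<in> G" "q \<in> G" "p \<noteq> q" "u = \<Union>(y ` p)" "v = \<Union>(y ` q)"
    by auto
  have sep: "\<forall>a\<in>y i. \<forall>b\<in>y j. a < b" if "i < j" for i j
    using y that by (auto simp: block_seq_def)
  have "(\<forall>i\<in>p. \<forall>j\<in>q. i < j) \<or> (\<forall>i\<in>q. \<forall>j\<in>p. i < j)"
    using G pq by (auto simp: ordered_family_iff)
  then show "(\<forall>a\<in>u. \<forall>b\<in>v. a < b) \<or> (\<forall>a\<in>v. \<forall>b\<in>u. a < b)"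
    unfolding pq using sep by (meson UN_E)
qed

text \<open>The index set can be recovered from the merged block: it consists of the
  \<open>i\<close> for which \<open>y i\<close> meets it.\<close>

lemma inj_merge:
  assumes y: "block_seq y"
  shows "inj (\<lambda>x. \<Union>(y ` x))"
proof -
  have disj: "i = j" if "a \<in> y i" "a \<in> y j" for a i j
    using y that by (metis block_seq_def less_irrefl linorder_neqE_nat)
  have "x = {i. y i \<inter> \<Union>(y ` x) \<noteq> {}}" for x
    using y disj by (auto simp: block_seq_def) blast
  then show ?thesis
    by (metis injI)
qed

section \<open>Diagonal block sequences\<close>

definition fin_enum :: "nat \<Rightarrow> nat set" where
  "fin_enum = from_nat_into fin_sets"

lemma fin_enum_in: "fin_enum k \<in> fin_sets"
  unfolding fin_enum_def by (rule from_nat_into) (auto simp: Fpow_def)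

lemma fin_enum_surj: "x \<in> fin_sets \<Longrightarrow> \<exists>k. fin_enum k = x"
  unfolding fin_enum_def by (metis countable_fin_sets from_nat_into_surj)

text \<open>Here \<open>p\<close> is the preceding block, with \<open>{}\<close> as a vacuous start.
  Block \<open>n\<close> has to lie only in \<open>W 0\<close>, ..., \<open>W n\<close>, as in a
  diagonal intersection.\<close>

definition next_block :: "(nat \<Rightarrow> nat set set) \<Rightarrow> nat \<Rightarrow> nat set \<Rightarrow> nat \<Rightarrow> bool" where
  "next_block W n p k \<longleftrightarrow>
     fin_enum k \<noteq> {} \<and> (\<forall>a\<in>p. \<forall>b\<in>fin_enum k. a < b) \<and> (\<forall>j\<in>{..n}. fin_enum k \<in> W j)"

text \<open>Choosing least codes, rather than arbitrary blocks, is what makes the diagonal sequence a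
  Borel function of \<open>W\<close>.\<close>

primrec diag_code :: "(nat \<Rightarrow> nat set set) \<Rightarrow> nat \<Rightarrow> nat" where
  "diag_code W 0 = (LEAST k. next_block W 0 {} k)"
| "diag_code W (Suc n) = (LEAST k. next_block W (Suc n) (fin_enum (diag_code W n)) k)"

definition diag_seq :: "(nat \<Rightarrow> nat set set) \<Rightarrow> nat \<Rightarrow> nat set" where
  "diag_seq W n = fin_enum (diag_code W n)"

lemma diag_seq_in_fin_sets: "diag_seq W n \<in> fin_sets"
  by (simp add: diag_seq_def fin_enum_in)

text \<open>The search inspects only finite sets, so a decoded set, known only up to its trace on
  \<open>fin_sets\<close>, produces the same sequence as the original.\<close>

lemma diag_seq_cong:
  assumes "\<And>j. W j \<inter> fin_sets = W' j \<inter> fin_sets"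
  shows "diag_seq W = diag_seq W'"
proof -
  have "fin_enum k \<in> W j \<longleftrightarrow> fin_enum k \<in> W' j" for j k
    using assms[of j] fin_enum_in[of k] by blast
  then have "next_block W = next_block W'"
    by (simp add: next_block_def fun_eq_iff)
  then have "diag_code W n = diag_code W' n" for n
    by (induction n) simp_all
  then show ?thesis by (simp add: diag_seq_def fun_eq_iff)
qed

text \<open>The hypothesis says that any finitely many of the \<open>W j\<close> share nonempty
  finite sets beyond every bound; hence the search for a least code always succeeds.\<close>

lemma diag_seq_block_seq:
  assumes "\<And>n m. \<exists>x\<in>fin_sets. x \<noteq> {} \<and> (\<forall>b\<in>x. m < b) \<and> (\<forall>j\<le>n. x \<in> W j)"
  shows "block_seq (diag_seq W)" and "\<And>j n. j \<le> n \<Longrightarrow> diag_seq W n \<in> W j"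
proof -
  have ex: "\<exists>k. next_block W n p k" if fin: "finite p" for n p
  proof -
    obtain m where m: "\<forall>a\<in>p. a \<le> m"
      using fin finite_nat_set_iff_bounded_le by blast
    obtain x where x: "x \<in> fin_sets" "x \<noteq> {}" "\<forall>b\<in>x. m < b" "\<forall>j\<le>n. x \<in> W j"
      using assms by meson
    obtain k where "fin_enum k = x" using fin_enum_surj x(1) by blast
    then have "next_block W n p k"
      using x m by (auto simp: next_block_def intro: le_less_trans)
    then show ?thesis ..
  qed
  have fin: "finite (diag_seq W n)" for n
    using diag_seq_in_fin_sets[of W n] by (simp add: Fpow_def)
  have step0: "next_block W 0 {} (diag_code W 0)"
    using ex[of "{}" 0] by (auto intro: LeastI_ex)
  have step: "next_block W (Suc n) (diag_seq W n) (diag_code W (Suc n))" for n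
    using ex[OF fin, of "Suc n" n] by (auto simp: diag_seq_def intro: LeastI_ex)
  show "diag_seq W n \<in> W j" if "j \<le> n" for j n
    using that step0 step by (cases n) (auto simp: next_block_def diag_seq_def)
  have ne: "diag_seq W n \<noteq> {}" for n
    using step0 step by (cases n) (auto simp: next_block_def diag_seq_def)
  have "\<forall>a\<in>diag_seq W m. \<forall>b\<in>diag_seq W n. a < b" if "m < n" for m n
    using that
  proof (induction n)
    case (Suc n)
    have 1: "\<forall>a\<in>diag_seq W n. \<forall>b\<in>diag_seq W (Suc n). a < b"
      using step[of n] by (auto simp: next_block_def diag_seq_def)
    show ?case
    proof (cases "m = n")
      case False
      then have "\<forall>a\<in>diag_seq W m. \<forall>b\<in>diag_seq W n. a < b"
        using Suc by simp
      then show ?thesis using 1 ne[of n] by (meson ex_in_conv less_trans)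
    qed (use 1 in simp)
  qed simp
  then show "block_seq (diag_seq W)"
    using fin ne by (auto simp: block_seq_def)
qed

text \<open>The next code depends on the previous one, which takes countably many values, so the
  measurable least searches for fixed previous codes can be pasted together. Points at which the
  search fails are covered too: \<open>LEAST\<close> has a fixed value there.\<close>

lemma measurable_diag_code:
  assumes W: "\<And>j z. z \<in> fin_sets \<Longrightarrow> Measurable.pred M (\<lambda>s. z \<in> W s j)"
  shows "(\<lambda>s. diag_code (W s) n) \<in> M \<rightarrow>\<^sub>M count_space UNIV"
proof (induction n)
  have P: "Measurable.pred M (\<lambda>s. next_block (W s) n p k)" for n p k
    unfolding next_block_def
    by (intro pred_intros_logic pred_intros_finite(3)[of "{..n}"] W fin_enum_in) auto
  {
    case 0
    show ?case by (simp, intro measurable_Least P)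
  next
    case (Suc n)
    have "(\<lambda>s. LEAST k. next_block (W s) (Suc n) (fin_enum c) k) \<in> M \<rightarrow>\<^sub>M count_space UNIV" for c
      by (intro measurable_Least P)
    from measurable_compose_countable[OF this Suc] show ?case by simp
  }
qed

lemma pred_merge_diag_seq:
  assumes W: "\<And>j z. z \<in> fin_sets \<Longrightarrow> Measurable.pred M (\<lambda>s. z \<in> W s j)"
    and A: "\<And>z. z \<in> fin_sets \<Longrightarrow> Measurable.pred M (\<lambda>s. z \<in> A s)"
    and x: "finite x"
  shows "Measurable.pred M (\<lambda>s. (\<Union>i\<in>x. diag_seq (W s) i) \<in> A s)"
proof -
  have D: "Measurable.pred M (\<lambda>s. m \<in> diag_seq (W s) i)" for m i
    unfolding diag_seq_def
    by (rule measurable_compose_countable[OF _ measurable_diag_code[OF W]]) auto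
  \<comment> \<open>Both the union and \<open>A s\<close> vary with \<open>s\<close>. Quantifying
    over the code of the union leaves only membership of fixed finite sets in
    \<open>A s\<close>.\<close>
  have eq: "(\<Union>i\<in>x. diag_seq (W s) i) \<in> A s \<longleftrightarrow>
      (\<exists>k. (\<forall>m. (\<exists>i\<in>x. m \<in> diag_seq (W s) i) \<longleftrightarrow> m \<in> fin_enum k) \<and> fin_enum k \<in> A s)" for s
  proof -
    have "(\<Union>i\<in>x. diag_seq (W s) i) \<in> fin_sets"
      using x diag_seq_in_fin_sets[of "W s"] by (auto simp: Fpow_def)
    then obtain k where k: "fin_enum k = (\<Union>i\<in>x. diag_seq (W s) i)"
      using fin_enum_surj by blast
    have "(\<forall>m. (\<exists>i\<in>x. m \<in> diag_seq (W s) i) \<longleftrightarrow> m \<in> fin_enum c) \<longleftrightarrow>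
        fin_enum c = (\<Union>i\<in>x. diag_seq (W s) i)" for c
      by blast
    then show ?thesis using k by metis
  qed
  show ?thesis
    unfolding eq
    by (intro pred_intros_countable pred_intros_logic pred_intros_finite(4) x D A fin_enum_in) auto
qed

section \<open>Towers of block sequences\<close>

lemma infinite_sets_distinct_representatives:
  fixes S :: "nat \<Rightarrow> 'a set"
  assumes "\<And>n. infinite (S n)"
  obtains r where "inj r" "\<And>n. r n \<in> S n"
proof -
  have "\<exists>r. \<forall>n. r n \<in> S n \<and> r n \<notin> r ` {..<n}"
  proof (rule dependent_wf_choice[of "{(m, n). m < n}"])
    show "wf {(m, n :: nat). m < n}" by (rule wf)
    fix f g :: "nat \<Rightarrow> 'a" and n r
    assume "\<And>z. (z, n) \<in> {(m, n). m < n} \<Longrightarrow> f z = g z"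
    then have "f ` {..<n} = g ` {..<n}" by (auto intro!: image_cong)
    then show "(r \<in> S n \<and> r \<notin> f ` {..<n}) = (r \<in> S n \<and> r \<notin> g ` {..<n})" by simp
  next
    fix n and f :: "nat \<Rightarrow> 'a"
    have "infinite (S n - f ` {..<n})" using assms by simp
    then have "S n - f ` {..<n} \<noteq> {}" by (rule infinite_imp_nonempty)
    then show "\<exists>r. r \<in> S n \<and> r \<notin> f ` {..<n}" by blast
  qed
  then obtain r where r: "\<And>n. r n \<in> S n" "\<And>n. r n \<notin> r ` {..<n}" by blast
  have "inj r"
    by (rule linorder_injI) (metis imageI lessThan_iff r(2))
  then show ?thesis using r(1) that by blast
qed

text \<open>Each member is listed twice, by \<open>n div 2\<close>, and receives two
  representatives. Those with even index form \<open>A\<close>; injectivity keeps those with odd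
  index out of it.\<close>

lemma splitting_set_for_countable_family:
  assumes "countable B" "\<And>b. b \<in> B \<Longrightarrow> infinite b"
  obtains A where "\<And>b. b \<in> B \<Longrightarrow> b \<inter> A \<noteq> {} \<and> \<not> b \<subseteq> A"
proof (cases "B = {}")
  case False
  define b where "b = from_nat_into B"
  have "infinite (b (n div 2))" for n
    using assms(2) False from_nat_into by (simp add: b_def from_nat_into)
  then obtain r where r: "inj r" "\<And>n. r n \<in> b (n div 2)"
    using infinite_sets_distinct_representatives[of "\<lambda>n. b (n div 2)"] by blast
  define A where "A = range (\<lambda>n. r (2 * n))"
  have "b n \<inter> A \<noteq> {} \<and> \<not> b n \<subseteq> A" for n
  proof -
    have "r (2 * n) \<in> b n" "r (2 * n + 1) \<in> b n"
      using r(2)[of "2 * n"] r(2)[of "2 * n + 1"] by simp_all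
    moreover have "r (2 * n + 1) \<noteq> r (2 * k)" for k
      using inj_eq[OF r(1)] by presburger
    ultimately show ?thesis unfolding A_def by blast
  qed
  moreover have "\<exists>n. b n = c" if "c \<in> B" for c
    unfolding b_def by (rule from_nat_into_surj[OF assms(1) that])
  ultimately show ?thesis
    by (metis that)
qed (use that in blast)

text \<open>These four properties carry the whole ultrafilter argument; the diamond principle is
  used only to produce such a tower.\<close>

locale deciding_tower =
  fixes X :: "omega1 \<Rightarrow> nat set set"
  assumes inf: "infinite (X \<alpha>)"
    and ord: "ordered_family (X \<alpha>)"
    and decr: "\<xi> < \<alpha> \<Longrightarrow> finite (X \<alpha> - FU (X \<xi>))"
    and decide: "A \<subseteq> fin_sets \<Longrightarrow> \<exists>\<alpha>. FU (X \<alpha>) \<subseteq> A \<or> FU (X \<alpha>) \<inter> A = {}"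
begin

definition base :: "nat set set set" where
  "base = {FU (tail m (X \<alpha>)) | \<alpha> m. True}"

definition ult :: "nat set set set" where
  "ult = {A. A \<subseteq> fin_sets \<and> (\<exists>\<alpha> m. FU (tail m (X \<alpha>)) \<subseteq> A)}"

lemma FU_X_subset: "FU (X \<alpha>) \<subseteq> fin_sets"
  by (rule FU_subset_fin_sets) (use ord[of \<alpha>] in \<open>simp add: ordered_family_def\<close>)

lemma FU_tail_X_subset: "FU (tail m (X \<alpha>)) \<subseteq> FU (X \<alpha>)"
  by (rule FU_mono[OF tail_subset])

lemma FU_tail_X_in_ult: "FU (tail m (X \<alpha>)) \<in> ult"
  using order_trans[OF FU_tail_X_subset FU_X_subset] by (auto simp: ult_def)

lemma FU_X_in_ult: "FU (X \<alpha>) \<in> ult"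
  unfolding ult_def using FU_X_subset FU_tail_X_subset by (intro CollectI conjI exI)

text \<open>The finitely many blocks of \<open>X \<alpha>\<close> outside
  \<open>FU (X \<xi>)\<close> are finite, so they are bounded by some \<open>m0\<close>, and no
  block of the tail beyond \<open>m0\<close> is exceptional.\<close>

lemma tail_below:
  assumes "\<xi> \<le> \<alpha>"
  shows "\<exists>m'. FU (tail m' (X \<alpha>)) \<subseteq> FU (tail m (X \<xi>))"
proof (cases "\<xi> = \<alpha>")
  case False
  then have "finite (X \<alpha> - FU (X \<xi>))"
    using assms decr by simp
  moreover have "finite x" if "x \<in> X \<alpha>" for x
    using ord[of \<alpha>] that by (auto simp: ordered_family_def Fpow_def)
  ultimately have "finite (\<Union>(X \<alpha> - FU (X \<xi>)))" by blast
  then obtain m0 where m0: "\<And>a x. x \<in> X \<alpha> \<Longrightarrow> x \<notin> FU (X \<xi>) \<Longrightarrow> a \<in> x \<Longrightarrow> a \<le> m0"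
    unfolding finite_nat_set_iff_bounded_le by blast
  have "tail (max m m0) (X \<alpha>) \<subseteq> FU (tail m (X \<xi>))"
  proof
    fix x assume x: "x \<in> tail (max m m0) (X \<alpha>)"
    \<comment> \<open>A nonempty block of the tail has a point above \<open>m0\<close>, which an
      exceptional block cannot have.\<close>
    then have "x \<noteq> {}" using ord[of \<alpha>] by (auto simp: tail_def ordered_family_def)
    then have "x \<in> FU (X \<xi>)"
      using x m0[of x] by (fastforce simp: tail_def)
    then show "x \<in> FU (tail m (X \<xi>))"
      using x unfolding FU_tail by (simp add: tail_def)
  qed
  then show ?thesis using FU_subset_FU by blast
qed auto

lemma infinite_ult:
  assumes "A \<in> ult"
  shows "infinite A"
proof -
  obtain \<alpha> m where "FU (tail m (X \<alpha>)) \<subseteq> A" using assms by (auto simp: ult_def)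
  then have "tail m (X \<alpha>) \<subseteq> A" using subset_FU by (rule order_trans[rotated])
  then show ?thesis using infinite_tail[OF ord inf] by (rule infinite_super)
qed

lemma ultrafilter: "ultrafilter_on fin_sets ult"
  unfolding ultrafilter_on_def
proof (intro conjI ballI allI impI)
  show "ult \<subseteq> Pow fin_sets" "fin_sets \<in> ult"
    using FU_tail_X_in_ult by (auto simp: ult_def)
  show "{} \<notin> ult" using infinite_ult by blast
  show "B \<in> ult" if "A \<in> ult" "A \<subseteq> B \<and> B \<subseteq> fin_sets" for A B
    using that unfolding ult_def by blast
  show "A \<inter> B \<in> ult" if A: "A \<in> ult" and B: "B \<in> ult" for A B
  proof -
    obtain \<alpha> m \<beta> n where AB: "FU (tail m (X \<alpha>)) \<subseteq> A" "FU (tail n (X \<beta>)) \<subseteq> B"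
      using A B unfolding ult_def by blast
    obtain m' n' where "FU (tail m' (X (max \<alpha> \<beta>))) \<subseteq> A" "FU (tail n' (X (max \<alpha> \<beta>))) \<subseteq> B"
      using tail_below[of \<alpha> "max \<alpha> \<beta>" m] tail_below[of \<beta> "max \<alpha> \<beta>" n] AB
      by (meson max.cobounded1 max.cobounded2 order_trans)
    then have "FU (tail (max m' n') (X (max \<alpha> \<beta>))) \<subseteq> A \<inter> B"
      by (auto simp: FU_tail)
    then show ?thesis using A unfolding ult_def by blast
  qed
  show "A \<in> ult \<or> fin_sets - A \<in> ult" if A: "A \<subseteq> fin_sets" for A
  proof -
    obtain \<alpha> where "FU (X \<alpha>) \<subseteq> A \<or> FU (X \<alpha>) \<inter> A = {}"
      using decide[OF A] by blast
    \<comment> \<open>Membership in \<open>ult\<close> is phrased with tails; \<open>tail 0\<close>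
      drops at most one block, the one containing 0.\<close>
    then have "FU (tail 0 (X \<alpha>)) \<subseteq> A \<or> FU (tail 0 (X \<alpha>)) \<subseteq> fin_sets - A"
      using FU_mono[OF tail_subset] FU_X_subset by blast
    then show ?thesis using A unfolding ult_def by blast
  qed
qed

lemma ordered_union: "ordered_union_ultrafilter ult"
  unfolding ordered_union_ultrafilter_def
proof (intro conjI ballI ultrafilter)
  fix A assume "A \<in> ult"
  then obtain \<alpha> m where "FU (tail m (X \<alpha>)) \<subseteq> A" by (auto simp: ult_def)
  then show "\<exists>X. infinite X \<and> ordered_family X \<and> FU X \<subseteq> A \<and> FU X \<in> ult"
    using infinite_tail[OF ord inf] ordered_family_subset[OF ord tail_subset] FU_tail_X_in_ult
    by blast
qed

lemma stable: "stable_union_ultrafilter ult"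
  unfolding stable_union_ultrafilter_def
proof (intro conjI allI impI)
  show "union_ultrafilter ult"
    using ordered_union ordered_family_imp_pairwise_disjoint
    unfolding union_ultrafilter_def ordered_union_ultrafilter_def by blast
  fix Y :: "nat \<Rightarrow> nat set set"
  assume "\<forall>n. pairwise_disjoint_family (Y n) \<and> FU (Y n) \<in> ult"
  then have "\<forall>n. \<exists>\<alpha> m. FU (tail m (X \<alpha>)) \<subseteq> FU (Y n)"
    by (simp add: ult_def)
  then obtain \<alpha> m where Y: "\<And>n. FU (tail (m n) (X (\<alpha> n))) \<subseteq> FU (Y n)"
    by metis
  \<comment> \<open>By regularity one level lies above the countably many witnesses, and
    \<open>X \<beta>\<close> is the required pseudo-intersection.\<close>
  obtain \<beta> where \<beta>: "\<And>n. \<alpha> n < \<beta>"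
    using countable_bounded_omega1[of "range \<alpha>"] by auto
  have "finite (X \<beta> - FU (Y n))" for n
  proof -
    obtain m' where "FU (tail m' (X \<beta>)) \<subseteq> FU (tail (m n) (X (\<alpha> n)))"
      using tail_below \<beta> less_imp_le by blast
    then have "tail m' (X \<beta>) \<subseteq> FU (Y n)"
      using Y subset_FU by blast
    then have "X \<beta> - FU (Y n) \<subseteq> X \<beta> - tail m' (X \<beta>)" by blast
    then show ?thesis using finite_diff_tail[OF ord] finite_subset by blast
  qed
  then show "\<exists>X. pairwise_disjoint_family X \<and> FU X \<in> ult \<and> (\<forall>n. finite (X - FU (Y n)))"
    using ordered_family_imp_pairwise_disjoint[OF ord] FU_X_in_ult by blast
qed

lemma uncountable_character:
  assumes "filter_base ult B"
  shows "cardSuc natLeq \<le>o |B|"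
proof (rule ccontr)
  assume "\<not> cardSuc natLeq \<le>o |B|"
  then have "countable B" by (rule countable_if_less_cardSuc_natLeq)
  moreover have B: "B \<subseteq> ult" "\<And>A. A \<in> ult \<Longrightarrow> \<exists>b\<in>B. b \<subseteq> A"
    using assms by (auto simp: filter_base_def)
  moreover from B(1) have "infinite b" if "b \<in> B" for b
    using that infinite_ult by blast
  ultimately obtain A where A: "\<And>b. b \<in> B \<Longrightarrow> b \<inter> A \<noteq> {} \<and> \<not> b \<subseteq> A"
    using splitting_set_for_countable_family[of B] by metis
  have "\<forall>A. A \<subseteq> fin_sets \<longrightarrow> A \<in> ult \<or> fin_sets - A \<in> ult"
    using ultrafilter by (simp add: ultrafilter_on_def)
  then have "A \<inter> fin_sets \<in> ult \<or> fin_sets - A \<inter> fin_sets \<in> ult"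
    by simp
  then obtain b where "b \<in> B" "b \<subseteq> A \<or> b \<subseteq> fin_sets - A \<inter> fin_sets"
    using B(2) by blast
  then show False using A[of b] by blast
qed

lemma character: "has_character ult (cardSuc natLeq)"
  unfolding has_character_def
proof (intro conjI allI impI uncountable_character)
  have base: "filter_base ult base"
    using FU_tail_X_in_ult by (fastforce simp: filter_base_def base_def ult_def)
  have "base = (\<lambda>(\<alpha>, m). FU (tail m (X \<alpha>))) ` (UNIV \<times> UNIV)"
    by (auto simp: base_def)
  then have "|base| \<le>o |(UNIV :: omega1 set) \<times> (UNIV :: nat set)|"
    by (simp only: card_of_image)
  also have "|(UNIV :: omega1 set) \<times> (UNIV :: nat set)| =o |UNIV :: omega1 set|"
    by (rule card_of_omega1_Times_countable) auto
  also note card_of_UNIV_omega1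
  finally have "|base| =o cardSuc natLeq"
    using uncountable_character[OF base] ordIso_iff_ordLeq by blast
  then show "\<exists>B. filter_base ult B \<and> |B| =o cardSuc natLeq"
    using base by blast
qed

end

section \<open>The tower obtained from the diamond principle\<close>

text \<open>For \<open>\<alpha> = 0\<close> the value \<open>from_nat_into {..<\<alpha>} j\<close> is arbitrary, whence the guard.\<close>

definition level_sets :: "omega1 \<Rightarrow> (omega1 \<Rightarrow> nat set set) \<Rightarrow> nat \<Rightarrow> nat set set" where
  "level_sets \<alpha> Z j =
     (if from_nat_into {..<\<alpha>} j < \<alpha> then Z (from_nat_into {..<\<alpha>} j) else fin_sets)"

text \<open>Left general in \<open>Z\<close>: the tower uses the sets \<open>FU (X \<xi>)\<close>,
  the Borel function the sets decoded from a point of the Cantor space.\<close>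

definition merge_level ::
    "omega1 \<Rightarrow> (omega1 \<Rightarrow> nat set set) \<Rightarrow> nat set \<Rightarrow> nat set" where
  "merge_level \<alpha> Z x = (\<Union>i\<in>x. diag_seq (level_sets \<alpha> Z) i)"

lemma merge_level_cong:
  assumes "\<And>\<xi>. \<xi> < \<alpha> \<Longrightarrow> Z \<xi> \<inter> fin_sets = Z' \<xi> \<inter> fin_sets"
  shows "merge_level \<alpha> Z = merge_level \<alpha> Z'"
proof -
  have "diag_seq (level_sets \<alpha> Z) = diag_seq (level_sets \<alpha> Z')"
    by (rule diag_seq_cong) (use assms in \<open>simp add: level_sets_def\<close>)
  then show ?thesis by (simp add: merge_level_def fun_eq_iff)
qed

text \<open>Well-founded recursion applies because \<open>merge_level \<alpha> Z\<close> reads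
  \<open>Z\<close> only below \<alpha>; the guard in \<open>level_sets\<close> ensures this also for
  \<alpha> = 0.\<close>

lemma tower_recursion:
  fixes g :: "omega1 \<Rightarrow> nat set set"
  obtains X where "\<And>\<alpha>. X \<alpha> = merge_level \<alpha> (\<lambda>\<xi>. FU (X \<xi>)) ` g \<alpha>"
proof -
  define R where "R = {(\<xi>, \<alpha>). \<xi> < (\<alpha> :: omega1)}"
  define H where "H = (\<lambda>X \<alpha>. merge_level \<alpha> (\<lambda>\<xi>. FU (X \<xi>)) ` g \<alpha>)"
  have "wf R" unfolding R_def by (rule wf)
  moreover have "adm_wf R H"
    unfolding adm_wf_def
  proof (intro allI impI)
    fix X X' :: "omega1 \<Rightarrow> nat set set" and \<alpha>
    assume "\<forall>\<xi>. (\<xi>, \<alpha>) \<in> R \<longrightarrow> X \<xi> = X' \<xi>"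
    then have "merge_level \<alpha> (\<lambda>\<xi>. FU (X \<xi>)) = merge_level \<alpha> (\<lambda>\<xi>. FU (X' \<xi>))"
      by (intro merge_level_cong) (simp add: R_def)
    then show "H X \<alpha> = H X' \<alpha>" by (simp add: H_def)
  qed
  ultimately have "wfrec R H = H (wfrec R H)" by (rule wfrec_fixpoint)
  then have "wfrec R H \<alpha> = merge_level \<alpha> (\<lambda>\<xi>. FU (wfrec R H \<xi>)) ` g \<alpha>" for \<alpha>
    by (metis H_def)
  then show ?thesis by (rule that)
qed

text \<open>Only finitely many levels are involved. If \<xi> is the largest, then
  \<open>X \<xi>\<close> is almost contained in \<open>FU (X \<eta>)\<close> for each of them, so
  all but finitely many of its blocks beyond \<open>m\<close> qualify.\<close>

lemma level_sets_large_elements: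
  assumes X: "\<And>\<xi>. \<xi> < \<alpha> \<Longrightarrow> infinite (X \<xi>) \<and> ordered_family (X \<xi>)"
    and decr: "\<And>\<xi> \<eta>. \<eta> < \<xi> \<Longrightarrow> \<xi> < \<alpha> \<Longrightarrow> finite (X \<xi> - FU (X \<eta>))"
  shows "\<exists>x\<in>fin_sets. x \<noteq> {} \<and> (\<forall>b\<in>x. m < b) \<and> (\<forall>j\<le>n. x \<in> level_sets \<alpha> (\<lambda>\<xi>. FU (X \<xi>)) j)"
proof -
  define S where "S = from_nat_into {..<\<alpha>} ` {..n} \<inter> {..<\<alpha>}"
  show ?thesis
  proof (cases "S = {}")
    case True
    then have "level_sets \<alpha> (\<lambda>\<xi>. FU (X \<xi>)) j = fin_sets" if "j \<le> n" for j
      using that by (auto simp: level_sets_def S_def)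
    then show ?thesis by (intro bexI[of _ "{Suc m}"]) (auto simp: Fpow_def)
  next
    case False
    define \<xi> where "\<xi> = Max S"
    have "finite S" by (simp add: S_def)
    then have "\<xi> \<in> S" using False by (simp add: \<xi>_def)
    then have "\<xi> < \<alpha>" by (simp add: S_def)
    then have Xi: "infinite (X \<xi>)" "ordered_family (X \<xi>)" using X by auto
    have "finite (X \<xi> - FU (X \<eta>))" if "\<eta> \<in> S" for \<eta>
    proof (cases "\<eta> = \<xi>")
      case True
      have "X \<xi> - FU (X \<xi>) = {}" using subset_FU by blast
      then show ?thesis using True by (metis finite.emptyI)
    next
      case False
      then have "\<eta> < \<xi>"
        using that \<open>finite S\<close> by (simp add: \<xi>_def le_neq_trans)
      then show ?thesis using decr \<open>\<xi> < \<alpha>\<close> by blast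
    qed
    then have "finite (\<Union>\<eta>\<in>S. X \<xi> - FU (X \<eta>))" using \<open>finite S\<close> by blast
    then have "infinite (tail m (X \<xi>) - (\<Union>\<eta>\<in>S. X \<xi> - FU (X \<eta>)))"
      using infinite_tail[OF Xi(2,1)] by simp
    then obtain x where "x \<in> tail m (X \<xi>)" "x \<notin> (\<Union>\<eta>\<in>S. X \<xi> - FU (X \<eta>))"
      using infinite_imp_nonempty by blast
    then have x: "x \<in> tail m (X \<xi>)" "\<And>\<eta>. \<eta> \<in> S \<Longrightarrow> x \<in> FU (X \<eta>)"
      using tail_subset by blast+
    have "x \<in> fin_sets" "x \<noteq> {}"
      using x(1) Xi(2) by (auto simp: tail_def ordered_family_def)
    moreover have "x \<in> level_sets \<alpha> (\<lambda>\<xi>. FU (X \<xi>)) j" if "j \<le> n" for j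
      using x(2) that \<open>x \<in> fin_sets\<close> by (auto simp: level_sets_def S_def)
    ultimately show ?thesis using x(1) by (auto simp: tail_def)
  qed
qed

lemma tower_properties:
  assumes g: "\<And>\<alpha>. infinite (g \<alpha>)" "\<And>\<alpha>. ordered_family (g \<alpha>)"
    and X: "\<And>\<alpha>. X \<alpha> = merge_level \<alpha> (\<lambda>\<xi>. FU (X \<xi>)) ` g \<alpha>"
  shows "infinite (X \<alpha>) \<and> ordered_family (X \<alpha>) \<and> (\<forall>\<xi><\<alpha>. finite (X \<alpha> - FU (X \<xi>)))"
proof (induction \<alpha> rule: less_induct)
  case (less \<alpha>)
  define W where "W = level_sets \<alpha> (\<lambda>\<xi>. FU (X \<xi>))"
  define y where "y = diag_seq W"
  have "\<exists>x\<in>fin_sets. x \<noteq> {} \<and> (\<forall>b\<in>x. m < b) \<and> (\<forall>j\<le>n. x \<in> W j)" for m n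
    unfolding W_def by (rule level_sets_large_elements) (use less in auto)
  from diag_seq_block_seq[of W, OF this]
  have y: "block_seq y" "\<And>j n. j \<le> n \<Longrightarrow> y n \<in> W j" unfolding y_def by blast+
  have X\<alpha>: "X \<alpha> = (\<lambda>x. \<Union>(y ` x)) ` g \<alpha>"
    by (subst X) (simp add: merge_level_def[abs_def] y_def W_def)
  have "infinite (X \<alpha>)"
    unfolding X\<alpha> using g(1) inj_merge[OF y(1)] by (meson finite_imageD inj_on_subset subset_UNIV)
  moreover have "ordered_family (X \<alpha>)"
    unfolding X\<alpha> by (rule ordered_family_merge[OF y(1) g(2)])
  moreover have "finite (X \<alpha> - FU (X \<xi>))" if "\<xi> < \<alpha>" for \<xi>
  proof -
    obtain j where j: "from_nat_into {..<\<alpha>} j = \<xi>"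
      using \<open>\<xi> < \<alpha>\<close> from_nat_into_surj[OF countable_lessThan_omega1, of \<xi> \<alpha>] by auto
    then have Wj: "W j = FU (X \<xi>)" using that by (simp add: W_def level_sets_def)
    \<comment> \<open>If all indices in \<open>x\<close> exceed \<open>j\<close>, the blocks merged
      along \<open>x\<close> lie in \<open>W j\<close>, that is, in \<open>FU (X \<xi>)\<close>.
      Only finitely many \<open>x\<close> in \<open>g \<alpha>\<close> fail this.\<close>
    have "\<Union>(y ` x) \<in> FU (X \<xi>)" if x: "x \<in> tail j (g \<alpha>)" for x
    proof (rule FU_closed_Union)
      show "y ` x \<subseteq> FU (X \<xi>)" using x y(2)[of j] Wj by (fastforce simp: tail_def)
      show "finite (y ` x)" "y ` x \<noteq> {}"
        using x g(2)[of \<alpha>] by (auto simp: tail_def ordered_family_def Fpow_def)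
    qed
    then have "X \<alpha> - FU (X \<xi>) \<subseteq> (\<lambda>x. \<Union>(y ` x)) ` (g \<alpha> - tail j (g \<alpha>))"
      unfolding X\<alpha> by blast
    then show ?thesis
      by (rule finite_subset) (intro finite_imageI finite_diff_tail g(2))
  qed
  ultimately show ?case by blast
qed

text \<open>A code is an injection \<open>e\<close>; a point \<open>s\<close> of \<open>2\<^sup>\<alpha>\<close> is read as the sequence of
  the sets coded by \<open>s (e (\<xi>, z, False))\<close>, \<open>\<xi> < \<alpha>\<close>, together with the set coded by
  \<open>s (e (\<xi>, z, True))\<close>, which in the intended codes is the same for all \<open>\<xi>\<close>.\<close>

definition decoded_set ::
    "(omega1 \<times> nat set \<times> bool \<Rightarrow> omega1) \<Rightarrow> bool \<Rightarrow> (omega1 \<Rightarrow> bool) \<Rightarrow> omega1 \<Rightarrow> nat set set" where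
  "decoded_set e t s \<xi> = {z \<in> fin_sets. s (e (\<xi>, z, t))}"

text \<open>At such levels, decoding the sets for \<xi> < \<alpha> reads only coordinates below
  \<alpha>, which a point of the level really has.\<close>

definition code_closed :: "(omega1 \<times> nat set \<times> bool \<Rightarrow> omega1) \<Rightarrow> omega1 \<Rightarrow> bool" where
  "code_closed e \<alpha> \<longleftrightarrow>
     (\<exists>\<beta>. \<beta> < \<alpha>) \<and> (\<forall>\<xi><\<alpha>. \<forall>i\<in>fin_sets \<times> UNIV. e (\<xi>, i) < \<alpha>)"

text \<open>The set to be decided is read off at \<open>from_nat_into {..<\<alpha>} 0\<close>, an
  arbitrary level below \<alpha>. The value \<open>{}\<close> at the remaining levels is harmless,
  since the closed levels form a club.\<close>

definition pull_back ::
    "(omega1 \<times> nat set \<times> bool \<Rightarrow> omega1) \<Rightarrow> omega1 \<Rightarrow> (omega1 \<Rightarrow> bool) \<Rightarrow> nat set set" where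
  "pull_back e \<alpha> s =
     (if code_closed e \<alpha> then
        {x \<in> fin_sets. merge_level \<alpha> (decoded_set e False s) x
           \<in> decoded_set e True s (from_nat_into {..<\<alpha>} 0)}
      else {})"

lemma borel_on_levels_pull_back: "borel_on_levels (pull_back e)"
  unfolding borel_on_levels_def
proof (intro allI conjI)
  fix \<alpha> :: omega1
  define M where "M = borel_algebra (cantor_space {..<\<alpha>})"
  show "pull_back e \<alpha> \<in> topspace (cantor_space {..<\<alpha>}) \<rightarrow> Pow fin_sets"
    by (auto simp: pull_back_def)
  have "Measurable.pred M (\<lambda>s. x \<in> pull_back e \<alpha> s)" if x: "x \<in> fin_sets" for x
  proof (cases "code_closed e \<alpha>")
    case True
    have dec: "Measurable.pred M (\<lambda>s. z \<in> decoded_set e t s \<xi>)"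
      if "z \<in> fin_sets" "\<xi> < \<alpha>" for z t \<xi>
    proof -
      \<comment> \<open>Closure makes this a genuine coordinate of the space, so decoding is a
        coordinate projection.\<close>
      have "e (\<xi>, z, t) \<in> {..<\<alpha>}" using True that by (auto simp: code_closed_def)
      from pred_cantor_space_component[OF this] show ?thesis
        using that(1) by (simp add: decoded_set_def M_def)
    qed
    have "from_nat_into {..<\<alpha>} 0 \<in> {..<\<alpha>}"
      by (rule from_nat_into) (use True in \<open>auto simp: code_closed_def\<close>)
    then have 0: "from_nat_into {..<\<alpha>} 0 < \<alpha>" by simp
    have "Measurable.pred M (\<lambda>s. z \<in> level_sets \<alpha> (decoded_set e False s) j)"
      if "z \<in> fin_sets" for z j
      using that dec by (simp add: level_sets_def)
    then have "Measurable.pred M (\<lambda>s. merge_level \<alpha> (decoded_set e False s) x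
        \<in> decoded_set e True s (from_nat_into {..<\<alpha>} 0))"
      unfolding merge_level_def
      by (intro pred_merge_diag_seq dec[OF _ 0]) (use x in \<open>auto simp: Fpow_def\<close>)
    then show ?thesis using True x by (simp add: pull_back_def)
  qed (simp add: pull_back_def)
  then show "(\<lambda>s. \<lambda>x\<in>fin_sets. x \<in> pull_back e \<alpha> s)
      \<in> borel_algebra (cantor_space {..<\<alpha>}) \<rightarrow>\<^sub>M borel_algebra (cantor_space fin_sets)"
    unfolding M_def[symmetric]
    by (intro measurable_into_cantor_space countable_fin_sets) (auto simp: topspace_cantor_space)
qed

lemma obtain_code:
  obtains e :: "omega1 \<times> nat set \<times> bool \<Rightarrow> omega1" where "inj_on e (UNIV \<times> fin_sets \<times> UNIV)"
proof -
  have "countable (fin_sets \<times> (UNIV :: bool set))" "fin_sets \<times> (UNIV :: bool set) \<noteq> {}"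
    using countable_fin_sets by (auto simp: Fpow_def)
  from card_of_omega1_Times_countable[OF this] obtain e where
    "bij_betw e ((UNIV :: omega1 set) \<times> fin_sets \<times> (UNIV :: bool set)) (UNIV :: omega1 set)"
    using card_of_ordIso by blast
  then show ?thesis using that bij_betw_imp_inj_on by blast
qed

theorem theorem3p4:
  assumes "diamond_hom_H"
  shows "\<exists>u. ordered_union_ultrafilter u \<and> stable_union_ultrafilter u \<and>
             has_character u (cardSuc natLeq)"
proof -
  obtain e :: "omega1 \<times> nat set \<times> bool \<Rightarrow> omega1" where e: "inj_on e (UNIV \<times> fin_sets \<times> UNIV)"
    by (rule obtain_code)
  obtain g where g: "\<And>\<alpha>. infinite (g \<alpha>)" "\<And>\<alpha>. ordered_family (g \<alpha>)"
    and st: "\<And>f. stationary {\<alpha>. FU_reaped (pull_back e \<alpha> (restrict f {..<\<alpha>})) (g \<alpha>)}"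
    using assms borel_on_levels_pull_back[of e] unfolding diamond_hom_H_def by blast
  obtain X where X: "\<And>\<alpha>. X \<alpha> = merge_level \<alpha> (\<lambda>\<xi>. FU (X \<xi>)) ` g \<alpha>"
    using tower_recursion[of g] by blast
  note props = tower_properties[OF g X]
  interpret deciding_tower X
  proof
    show "infinite (X \<alpha>)" "ordered_family (X \<alpha>)" for \<alpha>
      using props by blast+
    show "finite (X \<alpha> - FU (X \<xi>))" if "\<xi> < \<alpha>" for \<xi> \<alpha>
      using props that by blast
    fix A :: "nat set set" assume A: "A \<subseteq> fin_sets"
    \<comment> \<open>The tower was fixed from \<open>g\<close> before \<open>A\<close> was given,
      so a single branch can code all of \<open>FU (X \<xi>)\<close> together with
      \<open>A\<close>.\<close>
    define f where "f \<beta> = (case inv_into (UNIV \<times> fin_sets \<times> UNIV) e \<beta> of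
      (\<xi>, z, t) \<Rightarrow> if t then z \<in> A else z \<in> FU (X \<xi>))" for \<beta>
    have f: "f (e (\<xi>, z, t)) = (if t then z \<in> A else z \<in> FU (X \<xi>))" if "z \<in> fin_sets" for \<xi> z t
      using that by (simp add: f_def inv_into_f_f[OF e])
    have "club {\<alpha>. code_closed e \<alpha>}"
      unfolding code_closed_def
      using club_closed_under[of "fin_sets \<times> (UNIV :: bool set)" "\<lambda>\<xi> i. e (\<xi>, i)"]
        countable_fin_sets by simp
    then obtain \<alpha> where \<alpha>: "code_closed e \<alpha>"
      "FU_reaped (pull_back e \<alpha> (restrict f {..<\<alpha>})) (g \<alpha>)"
      using st[of f] unfolding stationary_def by blast
    \<comment> \<open>At a closed level, the restriction of \<open>f\<close> still contains every
      coordinate needed to recover these sets.\<close>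
    have dec: "decoded_set e t (restrict f {..<\<alpha>}) \<xi> = (if t then A else FU (X \<xi>)) \<inter> fin_sets"
      if "\<xi> < \<alpha>" for t \<xi>
      using \<alpha>(1) that f by (auto simp: decoded_set_def code_closed_def)
    have "from_nat_into {..<\<alpha>} 0 \<in> {..<\<alpha>}"
      by (rule from_nat_into) (use \<alpha>(1) in \<open>auto simp: code_closed_def\<close>)
    then have "decoded_set e True (restrict f {..<\<alpha>}) (from_nat_into {..<\<alpha>} 0) = A"
      using dec A by auto
    moreover have "merge_level \<alpha> (decoded_set e False (restrict f {..<\<alpha>}))
        = merge_level \<alpha> (\<lambda>\<xi>. FU (X \<xi>))"
      by (rule merge_level_cong) (use dec in auto)
    ultimately have "pull_back e \<alpha> (restrict f {..<\<alpha>})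
        = {x \<in> fin_sets. merge_level \<alpha> (\<lambda>\<xi>. FU (X \<xi>)) x \<in> A}"
      using \<alpha>(1) by (simp add: pull_back_def)
    \<comment> \<open>Merging maps \<open>FU (g \<alpha>)\<close> onto
      \<open>FU (X \<alpha>)\<close>. So if \<open>g \<alpha>\<close> reaps the pulled-back set,
      \<open>FU (X \<alpha>)\<close> lies inside \<open>A\<close> or misses it.\<close>
    moreover have "FU (X \<alpha>) = merge_level \<alpha> (\<lambda>\<xi>. FU (X \<xi>)) ` FU (g \<alpha>)"
      by (subst X) (simp only: merge_level_def[abs_def] FU_image_merge)
    moreover have "FU (g \<alpha>) \<subseteq> fin_sets"
      using g(2)[of \<alpha>] by (intro FU_subset_fin_sets) (simp add: ordered_family_def)
    ultimately have "FU (X \<alpha>) \<subseteq> A \<or> FU (X \<alpha>) \<inter> A = {}"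
      using \<alpha>(2) unfolding FU_reaped_def by auto
    then show "\<exists>\<alpha>. FU (X \<alpha>) \<subseteq> A \<or> FU (X \<alpha>) \<inter> A = {}" ..
  qed
  show ?thesis
    using ordered_union stable character by blast
qed

end
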